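(* Let ${\bf n}'=n'_1n'_2\cdots$ be the fixed point of $0\mapsto01$, $1\mapsto2$, $2\mapsto0$ starting with $0$, indexed from $1$. Let $P_i=\{k\ge1: n'_k=i\}$ for $i\in\{0,1,2\}$ and $P_{02}=\{k\ge1:n'_k\in\{0,2\}\}$. For sets $S,T$ let $S+T=\{s+t:s\in S,t\in T\}$. Then: (i) every $n\ge4$ lies in $P_{02}+P_{02}$; (ii) every $n\ge17$ lies in $P_0+P_0$; (iii) for every $i\ge0$, the integer $n=[(100)^i100000]_N$ does not lie in $P_1+P_1$; (iv) every $n\ge27$ lies in $P_1+P_1+P_1$; (v) for every $i\ge1$, the integer $n=[1(00)^i1]_N$ does not lie in $P_2+P_2$; (vi) every $n\ge140$ lies in $P_2+P_2+P_2$.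
   Context: Narayana numbers: $N_0=1,N_1=2,N_2=3$, $N_i=N_{i-1}+N_{i-3}$ for $i\ge3$. For a binary word $w=e_1\cdots e_t$, $[w]_N=\sum_{i=1}^t e_iN_{t-i}$; e.g. $[1001]_N=N_3+N_0=5$. *)

theory Defs
  imports Main "HOL-Library.Stream" "HOL-Library.Set_Algebras"
begin

fun narayana :: "nat \<Rightarrow> nat" where
  "narayana 0 = 1"
| "narayana (Suc 0) = 2"
| "narayana (Suc (Suc 0)) = 3"
| "narayana (Suc (Suc (Suc i))) = narayana (Suc (Suc i)) + narayana i"

text \<open>The letter \<open>e\<^sub>i\<close> of \<open>w = e\<^sub>1 \<cdots> e\<^sub>t\<close> is \<open>w ! (i - 1)\<close>.\<close>

definition narayana_val :: "nat list \<Rightarrow> nat" where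
  "narayana_val w = (\<Sum>i=1..length w. w ! (i - 1) * narayana (length w - i))"

lemma narayana_val_1001: "narayana_val [1, 0, 0, 1] = 5"
proof -
  have "{1..length [1, 0, 0, 1::nat]} = {1, 2, 3, 4}"
    by auto
  then show ?thesis
    by (simp add: narayana_val_def eval_nat_numeral)
qed

definition word_power :: "'a list \<Rightarrow> nat \<Rightarrow> 'a list" where
  "word_power u i = concat (replicate i u)"

text \<open>Only the values on the alphabet \<open>{0, 1, 2}\<close> are meaningful.\<close>

definition nar_subst :: "nat \<Rightarrow> nat list" where
  "nar_subst a = (if a = 0 then [0, 1] else if a = 1 then [2] else [0])"

text \<open>As \<open>nar_subst\<close> is non-erasing, its image of the infinite word \<open>w\<close> is \<open>flat (smap nar_subst w)\<close>.\<close>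

definition is_fixed_point :: "nat stream \<Rightarrow> bool" where
  "is_fixed_point w \<longleftrightarrow> w \<in> streams {0, 1, 2} \<and> flat (smap nar_subst w) = w \<and> shd w = 0"

definition fixed_word :: "nat stream" where
  "fixed_word = (THE w. is_fixed_point w)"

text \<open>Existence and uniqueness: \<open>unfold_queue\<close> emits the head of a queue and appends its image.\<close>

primcorec unfold_queue :: "nat list \<Rightarrow> nat stream" where
  "shd (unfold_queue q) = hd q"
| "stl (unfold_queue q) = unfold_queue (tl q @ nar_subst (hd q))"

lemma subst_nonempty: "nar_subst a \<noteq> []"
  by (simp add: nar_subst_def)

lemma set_subst: "set (nar_subst a) \<subseteq> {0, 1, 2}"
  by (simp add: nar_subst_def)

lemma flat_subst: "flat (smap nar_subst s) = nar_subst (shd s) @- flat (smap nar_subst (stl s))"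
  using flat_unfold[of "smap nar_subst s"] subst_nonempty by simp

lemma unfold_queue_snth:
  "q \<noteq> [] \<Longrightarrow> unfold_queue q !! n = (q @- flat (smap nar_subst (unfold_queue q))) !! n"
proof (induction n arbitrary: q)
  case 0
  then show ?case by (cases q) auto
next
  case (Suc n)
  then obtain x p where q: "q = x # p" by (cases q) auto
  have "unfold_queue q !! Suc n = unfold_queue (p @ nar_subst x) !! n"
    by (simp add: q)
  also have "\<dots> = ((p @ nar_subst x) @- flat (smap nar_subst (unfold_queue (p @ nar_subst x)))) !! n"
    by (rule Suc.IH) (simp add: subst_nonempty)
  also have "\<dots> = (p @- flat (smap nar_subst (unfold_queue q))) !! n"
    using flat_subst[of "unfold_queue q"] by (simp add: q)
  finally show ?case by (simp add: q)
qed

lemma unfold_queue_eq: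
  "q \<noteq> [] \<Longrightarrow> unfold_queue q = q @- flat (smap nar_subst (unfold_queue q))"
  using smap_alt[of "\<lambda>x. x" "unfold_queue q"] unfold_queue_snth[of q] by (simp add: stream.map_ident)

lemma unfold_queue_unique:
  assumes "q \<noteq> []" and "s = q @- flat (smap nar_subst s)"
  shows "s = unfold_queue q"
  using assms
proof (coinduction arbitrary: s q)
  case (Eq_stream s q)
  obtain x p where q: "q = x # p" using Eq_stream(1) by (cases q) auto
  have hd: "shd s = x"
    using arg_cong[OF Eq_stream(2), of shd] q by simp
  have tl: "stl s = (p @ nar_subst x) @- flat (smap nar_subst (stl s))"
    using arg_cong[OF Eq_stream(2), of stl] q hd flat_subst[of s] by simp
  have "p @ nar_subst x \<noteq> []"
    by (simp add: subst_nonempty)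
  with hd tl q show ?case
    by (auto intro!: exI[of _ "p @ nar_subst x"])
qed

lemma unfold_queue_streams:
  assumes "q \<noteq> []" and "set q \<subseteq> {0, 1, 2}"
  shows "unfold_queue q \<in> streams {0, 1, 2}"
  using assms
proof (coinduction arbitrary: q rule: streams.coinduct)
  case (streams q)
  have "\<exists>r. unfold_queue (tl q @ nar_subst (hd q)) = unfold_queue r \<and> r \<noteq> [] \<and> set r \<subseteq> {0, 1, 2}"
    using streams set_subst[of "hd q"] subst_nonempty[of "hd q"]
    by (intro exI[of _ "tl q @ nar_subst (hd q)"]) (cases q, auto)
  moreover have "hd q \<in> {0, 1, 2}"
    using streams by (cases q) auto
  ultimately show ?case
    by (intro exI[of _ "hd q"] exI[of _ "unfold_queue (tl q @ nar_subst (hd q))"])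
       (auto simp: unfold_queue.code[of q])
qed

lemma ex1_fixed_point: "\<exists>!w. is_fixed_point w"
proof (rule ex1I)
  let ?w = "0 ## unfold_queue [1]"
  have "flat (smap nar_subst ?w) = ?w"
    using flat_subst[of ?w] unfold_queue_eq[of "[1]"] by (simp add: nar_subst_def)
  moreover have "?w \<in> streams {0, 1, 2}"
    using unfold_queue_streams[of "[1]"] by (simp add: streams_Stream)
  ultimately show "is_fixed_point ?w"
    by (simp add: is_fixed_point_def)
next
  fix w assume w: "is_fixed_point w"
  have "stl w = [1] @- flat (smap nar_subst (stl w))"
    using w arg_cong[OF flat_subst[of w], of stl]
    by (simp add: is_fixed_point_def nar_subst_def)
  then have "stl w = unfold_queue [1]"
    by (intro unfold_queue_unique) auto
  with w show "w = 0 ## unfold_queue [1]"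
    by (metis is_fixed_point_def stream.collapse)
qed

lemma is_fixed_point_fixed_word: "is_fixed_point fixed_word"
  unfolding fixed_word_def by (rule theI') (rule ex1_fixed_point)

text \<open>Streams are indexed from \<open>0\<close>, the word in question from \<open>1\<close>.\<close>

definition letter :: "nat \<Rightarrow> nat" where
  "letter k = fixed_word !! (k - 1)"

definition Pos :: "nat \<Rightarrow> nat set" where
  "Pos i = {k. k \<ge> 1 \<and> letter k = i}"

definition Pos02 :: "nat set" where
  "Pos02 = {k. k \<ge> 1 \<and> letter k \<in> {0, 2}}"

end

theory Submission
  imports Defs
begin

text \<open>
  Write \<open>w\<close> for the fixed point, indexed from \<open>0\<close>, and \<open>s x\<close> for the length of the image of its prefix
  of length \<open>x\<close>; then \<open>s (s (s x)) = s (s x) + x\<close>.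

  Parts (i), (ii), (iv), (vi): there is a finite set \<open>S\<close> of elements of \<open>P\<close> (resp. \<open>P + P\<close>) such that
  every large \<open>n\<close> has some \<open>s \<in> S\<close> with \<open>n - s \<in> P\<close>. This depends only on a window of bounded length in
  front of \<open>n\<close>. The factors of length 2 of \<open>w\<close> all occur in its prefix \<open>0120010\<close>, hence every window of
  length at most the least \<open>|\<sigma>\<^sup>k(a)|\<close> occurs in \<open>\<sigma>\<^sup>k(0120010)\<close>, and a finite computation remains.

  Parts (iii), (v): the integers are \<open>N\<^sub>K - 4\<close> and \<open>N\<^sub>K + 1\<close>. For \<open>v x = (x, s x, s (s x))\<close> consider
  \<open>D = v x + v y - v N\<^sub>K\<close>. When \<open>K\<close> grows by one and \<open>x\<close>, \<open>y\<close> are replaced by positions inside their images,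
  \<open>D\<close> changes by a non-negative linear map plus a digit contribution. As the map is hyperbolic with a
  single expanding direction, \<open>D\<close> either enters an invariant positive or negative cone or stays in a finite
  set of states, and none of these allows the forbidden values.
\<close>

section \<open>The fixed point as a self-similar word\<close>

declare snth.simps [simp del] stake.simps(2) [simp del]

definition subst_word :: "nat list \<Rightarrow> nat list" where
  "subst_word u = concat (map nar_subst u)"

abbreviation pre :: "nat \<Rightarrow> nat list" where
  "pre n \<equiv> stake n fixed_word"

definition stretch :: "nat \<Rightarrow> nat" where
  "stretch p = length (subst_word (pre p))"

lemma subst_word_simps [simp]:
  "subst_word [] = []"
  "subst_word (a # u) = nar_subst a @ subst_word u"
  "subst_word (u @ v) = subst_word u @ subst_word v"
  by (simp_all add: subst_word_def)

lemma flat_subst_split: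
  "flat (smap nar_subst s) = subst_word (stake p s) @- flat (smap nar_subst (sdrop p s))"
proof (induction p arbitrary: s)
  case (Suc p)
  show ?case
    by (subst flat_subst, subst Suc.IH) (simp add: stake.simps)
qed simp

lemma fixed_word_image: "flat (smap nar_subst fixed_word) = fixed_word"
  using is_fixed_point_fixed_word by (simp add: is_fixed_point_def)

lemma fixed_word_0: "fixed_word !! 0 = 0"
  using is_fixed_point_fixed_word by (simp add: is_fixed_point_def snth.simps)

lemma fixed_word_letters: "fixed_word !! n \<in> {0, 1, 2}"
  using is_fixed_point_fixed_word snth_sset[of fixed_word n]
  unfolding is_fixed_point_def streams_iff_sset by blast

lemma pre_stretch: "pre (stretch p) = subst_word (pre p)"
proof -
  have "stake (stretch p) (flat (smap nar_subst fixed_word)) = subst_word (pre p)"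
    unfolding flat_subst_split[of fixed_word p] by (simp add: stake_shift stretch_def)
  then show ?thesis
    by (simp only: fixed_word_image)
qed

lemma stretch_0 [simp]: "stretch 0 = 0"
  by (simp add: stretch_def)

lemma stretch_Suc: "stretch (Suc p) = stretch p + length (nar_subst (fixed_word !! p))"
  by (simp add: stretch_def stake_Suc)

lemma fixed_word_stretch:
  assumes "j < length (nar_subst (fixed_word !! p))"
  shows "fixed_word !! (stretch p + j) = nar_subst (fixed_word !! p) ! j"
proof -
  have "pre (stretch (Suc p)) = subst_word (pre p) @ nar_subst (fixed_word !! p)"
    by (simp add: pre_stretch stake_Suc)
  then have "pre (stretch (Suc p)) ! (stretch p + j) = nar_subst (fixed_word !! p) ! j"
    by (simp add: nth_append stretch_def)
  moreover have "stretch p + j < stretch (Suc p)"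
    using assms by (simp add: stretch_Suc)
  ultimately show ?thesis
    by (simp add: stake_nth)
qed

lemma length_subst_pos: "0 < length (nar_subst a)"
  by (simp add: subst_nonempty)

lemma stretch_mono: "x \<le> y \<Longrightarrow> stretch x \<le> stretch y"
  by (rule lift_Suc_mono_le[of stretch]) (simp_all add: stretch_Suc)

lemma stretch_gt: "0 < p \<Longrightarrow> p < stretch p"
proof (induction p rule: nat_induct_non_zero)
  case 1
  then show ?case using fixed_word_0 by (simp add: stretch_Suc nar_subst_def)
next
  case (Suc p)
  then show ?case
    using length_subst_pos[of "fixed_word !! p"] stretch_Suc[of p] by linarith
qed

section \<open>Desubstitution and the factors of length two\<close>

lemma step_function_cover:
  fixes f :: "nat \<Rightarrow> nat"
  assumes "f 0 = 0" and "x < f m"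
  obtains p where "f p \<le> x" and "x < f (Suc p)"
proof -
  define q where "q = (LEAST q. x < f q)"
  have q: "x < f q"
    unfolding q_def using assms(2) by (rule LeastI)
  have least: "\<not> x < f r" if "r < q" for r
    using that unfolding q_def by (rule not_less_Least)
  have "q \<noteq> 0"
    using q assms(1) by (cases q) auto
  then obtain p where "q = Suc p"
    by (cases q) auto
  with q least[of p] show thesis
    by (intro that[of p]) auto
qed

lemma position_in_image:
  obtains p j where "x = stretch p + j" and "j < length (nar_subst (fixed_word !! p))"
proof -
  obtain p where "stretch p \<le> x" "x < stretch (Suc p)"
    using step_function_cover[of stretch x "Suc x"] stretch_gt[of "Suc x"] by auto
  then have "x = stretch p + (x - stretch p)" "x - stretch p < length (nar_subst (fixed_word !! p))"
    using stretch_Suc[of p] by linarith+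
  then show thesis
    by (rule that)
qed

text \<open>A pair is either the image 01 of a letter 0 or straddles two adjacent images. In the
  latter case it is determined by the pair at an earlier position \<open>p\<close>, and the five
  listed pairs are closed under this passage.\<close>

lemma fixed_word_pairs:
  "(fixed_word !! q, fixed_word !! Suc q) \<in> {(0, 1), (1, 2), (2, 0), (0, 0), (1, 0)}"
proof (induction q rule: less_induct)
  case (less q)
  obtain p j where q: "q = stretch p + j" and j: "j < length (nar_subst (fixed_word !! p))"
    by (rule position_in_image)
  show ?case
  proof (cases "fixed_word !! p = 0 \<and> j = 0")
    case True
    then show ?thesis
      using fixed_word_stretch[of 0 p] fixed_word_stretch[of 1 p] by (simp add: q nar_subst_def)
  next
    case False
    then have "Suc q = stretch (Suc p)"
      using j by (auto simp: q stretch_Suc nar_subst_def split: if_splits)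
    moreover have "fixed_word !! stretch (Suc p) = nar_subst (fixed_word !! Suc p) ! 0"
      using fixed_word_stretch[of 0 "Suc p"] length_subst_pos[of "fixed_word !! Suc p"] by simp
    moreover have "p < q"
    proof (cases "p = 0")
      case True
      then show ?thesis using False q fixed_word_0 by auto
    next
      case p: False
      then show ?thesis using q stretch_gt[of p] by simp
    qed
    ultimately show ?thesis
      using less.IH[of p] False j fixed_word_stretch[OF j]
      by (auto simp: q nar_subst_def split: if_splits)
  qed
qed

text \<open>Letter by letter: the third images of 0, 1, 2 have lengths 4, 2, 3 and the second images
  3, 1, 2.\<close>

lemma length_subst_word3:
  "length (subst_word (subst_word (subst_word u))) = length (subst_word (subst_word u)) + length u"
  by (induction u) (auto simp: nar_subst_def)

lemma stretch3: "stretch (stretch (stretch p)) = stretch (stretch p) + p"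
proof -
  have eq: "stretch (stretch q) = length (subst_word (subst_word (pre q)))" for q
    unfolding stretch_def[of "stretch q"] pre_stretch ..
  have "stretch (stretch (stretch p)) = length (subst_word (subst_word (subst_word (pre p))))"
    unfolding eq[of "stretch p"] pre_stretch ..
  also have "\<dots> = stretch (stretch p) + p"
    unfolding eq[of p] length_subst_word3 by simp
  finally show ?thesis .
qed

text \<open>\<open>e = 1\<close> occurs only at a letter 0, whose image starts with 0; passing that
  0 adds |sigma(0)| = 2 and |sigma^2(0)| = 3. So the vector (x, s x, s (s x)) of a child is affine
  in that of its parent.\<close>

lemma stretch_child:
  assumes "e < length (nar_subst (fixed_word !! p))"
  shows "stretch (stretch p + e) = stretch (stretch p) + 2 * e"
    and "stretch (stretch (stretch p + e)) = stretch (stretch p) + p + 3 * e"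
proof -
  have "e = 0 \<or> e = 1 \<and> fixed_word !! p = 0"
    using assms by (auto simp: nar_subst_def split: if_splits)
  moreover
  {
    assume p0: "fixed_word !! p = 0"
    have a: "fixed_word !! stretch p = 0"
      using fixed_word_stretch[of 0 p] p0 by (simp add: nar_subst_def)
    have b: "fixed_word !! stretch (stretch p) = 0"
      using fixed_word_stretch[of 0 "stretch p"] a by (simp add: nar_subst_def)
    have c: "fixed_word !! Suc (stretch (stretch p)) = 1"
      using fixed_word_stretch[of 1 "stretch p"] a by (simp add: nar_subst_def)
    have d: "stretch (Suc (stretch p)) = Suc (Suc (stretch (stretch p)))"
      using a by (simp add: stretch_Suc nar_subst_def)
    have "stretch (stretch (Suc (stretch p))) = stretch (stretch (stretch p)) + 3"
      unfolding d by (simp add: stretch_Suc b c) (simp add: nar_subst_def)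
    note d this
  }
  ultimately show "stretch (stretch p + e) = stretch (stretch p) + 2 * e"
    and "stretch (stretch (stretch p + e)) = stretch (stretch p) + p + 3 * e"
    by (auto simp: stretch3)
qed

section \<open>Windows of bounded length\<close>

lemma funpow_subst_word_append: "(subst_word ^^ k) (u @ v) = (subst_word ^^ k) u @ (subst_word ^^ k) v"
  by (induction k) simp_all

lemma funpow_subst_word_Nil [simp]: "(subst_word ^^ k) [] = []"
  by (induction k) simp_all

lemma funpow_subst_word_pre: "pre (length ((subst_word ^^ k) (pre p))) = (subst_word ^^ k) (pre p)"
proof (induction k)
  case (Suc k)
  define m where "m = length ((subst_word ^^ k) (pre p))"
  have "(subst_word ^^ k) (pre p) = pre m"
    using Suc by (simp add: m_def)
  then show ?case
    using pre_stretch[of m] by (simp add: stretch_def)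
qed simp

lemma length_subst_word: "length u \<le> length (subst_word u)"
proof (induction u)
  case (Cons a u)
  then show ?case using subst_nonempty[of a] by (cases "nar_subst a") auto
qed simp

lemma length_funpow_subst_word: "length u \<le> length ((subst_word ^^ k) u)"
proof (induction k)
  case (Suc k)
  then show ?case using length_subst_word[of "(subst_word ^^ k) u"] by simp
qed simp

section \<open>Narayana numbers as lengths of iterated images\<close>

lemma length_funpow_subst_word_0: "length ((subst_word ^^ K) [0]) = narayana K"
proof (induction K rule: narayana.induct)
  case (4 i)
  then show ?case
    using length_subst_word3[of "(subst_word ^^ i) [0]"] by simp
qed (simp_all add: nar_subst_def)

lemma pre_1: "pre 1 = [0]"
  using fixed_word_0 by (simp add: stake_Suc)

lemma pre_narayana: "pre (narayana K) = (subst_word ^^ K) [0]"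
  using funpow_subst_word_pre[of K 1] unfolding pre_1 by (simp add: length_funpow_subst_word_0)

lemma stretch_narayana: "stretch (narayana K) = narayana (Suc K)"
  using length_funpow_subst_word_0[of "Suc K"] by (simp add: stretch_def pre_narayana)

lemma pre_7: "pre 7 = [0, 1, 2, 0, 0, 1, 0]"
proof -
  have "pre 7 = take 7 (pre (narayana 5))"
    by (simp add: take_stake eval_nat_numeral)
  also have "\<dots> = [0, 1, 2, 0, 0, 1, 0]"
    unfolding pre_narayana by code_simp
  finally show ?thesis .
qed

lemma pairs_in_pre_7:
  obtains q' where "q' < 6" and "fixed_word !! q' = fixed_word !! q"
    and "fixed_word !! Suc q' = fixed_word !! Suc q"
proof -
  have nth: "\<And>i. i < 7 \<Longrightarrow> fixed_word !! i = [0, 1, 2, 0, 0, 1, 0] ! i"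
    using stake_nth[of _ 7 fixed_word] pre_7 by metis
  \<comment> \<open>Positions 0, 1, 2, 3, 5 start the pairs 01, 12, 20, 00, 10.\<close>
  have "\<exists>q'\<in>{0, 1, 2, 3, 5}. fixed_word !! q' = fixed_word !! q \<and> fixed_word !! Suc q' = fixed_word !! Suc q"
    using fixed_word_pairs[of q] by (auto simp: nth)
  then obtain q' where "q' \<in> {0, 1, 2, 3, 5}" and eq: "fixed_word !! q' = fixed_word !! q"
    "fixed_word !! Suc q' = fixed_word !! Suc q"
    by blast
  from this(1) have "q' < 6" by auto
  from this eq show thesis by (rule that)
qed

text \<open>\<open>x\<close> lies in the block sigma^k(a) of some letter a. Blocks have length at
  least \<open>C\<close>, so looking back by at most \<open>C\<close> reaches no further than the
  preceding block, and the two letters concerned recur in \<open>pre 7\<close>. An \<open>x\<close>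
  in the very first block is kept, whence the alternative \<open>x' = x\<close>.\<close>

lemma window_occurs_early:
  assumes C: "\<And>a. a \<in> {0, 1, 2} \<Longrightarrow> C \<le> length ((subst_word ^^ k) [a])"
  obtains x' where "x' < length ((subst_word ^^ k) (pre 7))" and "x' = x \<or> C \<le> x' \<and> C \<le> x"
    and "\<And>d. d \<le> C \<Longrightarrow> d \<le> x \<Longrightarrow> fixed_word !! (x' - d) = fixed_word !! (x - d)"
proof -
  define f where "f p = length ((subst_word ^^ k) (pre p))" for p
  define u where "u p = (subst_word ^^ k) [fixed_word !! p]" for p
  have split: "(subst_word ^^ k) (pre (Suc p)) = (subst_word ^^ k) (pre p) @ u p" for p
    by (simp add: stake_Suc funpow_subst_word_append u_def)
  have f_Suc: "f (Suc p) = f p + length (u p)" for p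
    using split[of p] by (simp add: f_def)
  have C: "C \<le> length (u p)" for p
    unfolding u_def by (rule C) (rule fixed_word_letters)
  have f_mono: "p \<le> q \<Longrightarrow> f p \<le> f q" for p q
    by (rule lift_Suc_mono_le[of f]) (simp_all add: f_Suc)
  have "x < f (Suc x)"
    using length_funpow_subst_word[of "pre (Suc x)" k] by (simp add: f_def)
  then obtain p where p: "f p \<le> x" "x < f (Suc p)"
    using step_function_cover[of f x "Suc x"] by (auto simp: f_def)
  show thesis
  proof (cases p)
    case 0
    have "f (Suc 0) \<le> f 7" by (rule f_mono) simp
    then show thesis
      using p 0 by (intro that[of x]) (auto simp: f_def)
  next
    case (Suc q)
    obtain q' where q': "q' < 6" "fixed_word !! q' = fixed_word !! q" "fixed_word !! Suc q' = fixed_word !! Suc q"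
      by (rule pairs_in_pre_7)
    have u: "u q' = u q" "u (Suc q') = u (Suc q)"
      using q' by (simp_all add: u_def)
    have nth: "fixed_word !! (f r + i) = (u r @ u (Suc r)) ! i" if "i < length (u r @ u (Suc r))" for r i
    proof -
      have "pre (f (Suc (Suc r))) = (subst_word ^^ k) (pre r) @ u r @ u (Suc r)"
        using funpow_subst_word_pre[of k "Suc (Suc r)"] split[of r] split[of "Suc r"]
        by (simp add: f_def)
      then have "pre (f (Suc (Suc r))) ! (f r + i) = (u r @ u (Suc r)) ! i"
        by (simp add: nth_append f_def)
      then show ?thesis
        using that by (simp add: stake_nth f_Suc)
    qed
    \<comment> \<open>The offset is counted from the start of the block preceding the one that
      contains \<open>x\<close>.\<close>
    define i where "i = x - f q"
    have x: "x = f q + i" and i: "length (u q) \<le> i" "i < length (u q @ u (Suc q))"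
      using p Suc by (auto simp: i_def f_Suc)
    have "f (Suc (Suc q')) \<le> f 7"
      by (rule f_mono) (use q' in simp)
    then have "f q' + i < f 7"
      using i u by (simp add: f_Suc)
    moreover have "C \<le> i"
      using C[of q] i by simp
    moreover have "fixed_word !! (f q' + i - d) = fixed_word !! (x - d)" if "d \<le> C" for d
    proof -
      have "d \<le> i" using that \<open>C \<le> i\<close> by simp
      then show ?thesis
        using nth[of "i - d" q] nth[of "i - d" q'] i u x by simp
    qed
    ultimately show thesis
      using x by (intro that[of "f q' + i"]) (auto simp: f_def)
  qed
qed

text \<open>Delaying whole copies of \<open>B\<close> by the elements of \<open>S\<close>, instead of testing each position by indexing,
  keeps the symbolic evaluation of \<open>shifts_cover\<close> feasible.\<close>

definition superpose :: "bool list \<Rightarrow> nat \<Rightarrow> nat list \<Rightarrow> bool list" where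
  "superpose B c S =
    foldr (\<lambda>s acc. map2 (\<or>) (drop c (replicate s False @ B)) acc) S (map (\<lambda>_. False) (drop c B))"

definition shifts_cover :: "bool list \<Rightarrow> nat \<Rightarrow> nat list \<Rightarrow> bool" where
  "shifts_cover B c S \<longleftrightarrow> list_all id (superpose B c S)"

lemma length_superpose: "length (superpose B c S) = length B - c"
  by (induction S) (auto simp: superpose_def)

text \<open>Entry \<open>i\<close> stands for position \<open>c + i\<close>; prepending
  \<open>s\<close> copies of \<open>False\<close> delays \<open>B\<close> by \<open>s\<close> and
  makes positions before \<open>s\<close> fail.\<close>

lemma nth_superpose:
  assumes "c + i < length B"
  shows "superpose B c S ! i \<longleftrightarrow> (\<exists>s\<in>set S. s \<le> c + i \<and> B ! (c + i - s))"
proof (induction S)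
  case Nil
  then show ?case using assms by (simp add: superpose_def)
next
  case (Cons s S)
  have "superpose B c (s # S) = map2 (\<or>) (drop c (replicate s False @ B)) (superpose B c S)"
    by (simp add: superpose_def)
  moreover have "i < length (drop c (replicate s False @ B))" "i < length (superpose B c S)"
    using assms by (auto simp: length_superpose)
  moreover have "drop c (replicate s False @ B) ! i \<longleftrightarrow> s \<le> c + i \<and> B ! (c + i - s)"
    using assms by (auto simp: nth_append nth_drop simp del: drop_append)
  ultimately show ?case
    using Cons by simp
qed

text \<open>The window is moved to an early one, a shift is read off there and carried back. Since
  \<open>c \<le> C\<close>, a moved window still ends at or after \<open>c\<close>, where coverage
  was tested.\<close>

lemma shifts_cover_fixed_word:
  assumes cover: "shifts_cover (map Q ((subst_word ^^ k) [0, 1, 2, 0, 0, 1, 0])) c S"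
    and long: "list_all (\<lambda>a. C \<le> length ((subst_word ^^ k) [a])) [0, 1, 2]"
    and S: "list_all (\<lambda>s. s \<le> C) S" and "c \<le> C" and "c < n"
  obtains s where "s \<in> set S" and "s < n" and "Q (letter (n - s))"
proof -
  let ?u = "(subst_word ^^ k) (pre 7)"
  \<comment> \<open>Counting from 0, \<open>letter (n - s)\<close> is
    \<open>fixed_word !! (x - s)\<close>.\<close>
  define x where "x = n - 1"
  have n: "n = Suc x" and x: "c \<le> x"
    using \<open>c < n\<close> by (simp_all add: x_def)
  obtain x' where x': "x' < length ?u" "x' = x \<or> C \<le> x' \<and> C \<le> x"
    and eq: "\<And>d. d \<le> C \<Longrightarrow> d \<le> x \<Longrightarrow> fixed_word !! (x' - d) = fixed_word !! (x - d)"
  proof (rule window_occurs_early)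
    show "a \<in> {0, 1, 2} \<Longrightarrow> C \<le> length ((subst_word ^^ k) [a])" for a
      using long by auto
  qed blast
  have "c \<le> x'"
    using x x' \<open>c \<le> C\<close> by auto
  then have i: "c + (x' - c) = x'" by simp
  have "superpose (map Q ?u) c S ! (x' - c)"
    using cover x'(1) i unfolding shifts_cover_def pre_7 list_all_length
    by (auto simp: length_superpose)
  then obtain s where s: "s \<in> set S" "s \<le> x'" "map Q ?u ! (x' - s)"
    using nth_superpose[of c "x' - c" "map Q ?u" S] x'(1) i by auto
  have "?u ! (x' - s) = fixed_word !! (x' - s)"
    using funpow_subst_word_pre[of k 7] x'(1) by (metis less_imp_diff_less stake_nth)
  then have "Q (fixed_word !! (x' - s))"
    using s(3) x'(1) by simp
  moreover have "s \<le> x"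
    using s x'(2) S by (auto simp: list_all_iff)
  ultimately have "Q (fixed_word !! (x - s))"
    using eq[of s] S s(1) by (auto simp: list_all_iff)
  with s(1) \<open>s \<le> x\<close> show thesis
    by (intro that[of s]) (auto simp: n letter_def)
qed

section \<open>Differences of positions\<close>

text \<open>The states reachable from \<open>(0, 0, - 1, - 2, - 3)\<close> outside the two cones of \<open>safe\<close>: a pair of letters,
  taken up to order, followed by the difference vector \<open>D\<close>.\<close>

definition core :: "(nat \<times> nat \<times> int \<times> int \<times> int) list" where
  "core =
   [(0, 0, -6, -9, -13), (0, 0, -5, -7, -10), (0, 0, -4, -7, -10), (0, 0, -4, -6, -9),
    (0, 0, -3, -5, -7), (0, 0, -3, -4, -6), (0, 0, -2, -3, -4), (0, 0, -1, -2, -3),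
    (0, 0, -1, -1, -2), (0, 0, -1, -1, -1), (0, 0, 0, -1, -1), (0, 1, -6, -9, -13),
    (0, 1, -6, -8, -12), (0, 1, -6, -8, -11), (0, 1, -5, -7, -10), (0, 1, -4, -5, -7),
    (0, 1, -3, -4, -6), (0, 1, -2, -3, -4), (0, 1, -2, -2, -3), (0, 1, -1, -1, -1),
    (0, 2, -5, -8, -12), (0, 2, -5, -7, -11), (0, 2, -4, -6, -9), (0, 2, -3, -4, -6),
    (0, 2, -2, -3, -5), (0, 2, -1, -2, -3), (0, 2, -1, -1, -2), (1, 1, -5, -6, -9),
    (1, 1, -5, -6, -8), (1, 1, -4, -5, -7), (1, 1, -3, -3, -4), (1, 1, -2, -2, -3),
    (1, 1, -1, 0, 0), (1, 2, -6, -8, -12), (1, 2, -4, -5, -8), (1, 2, -3, -4, -6),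
    (1, 2, -2, -2, -3), (1, 2, -1, -1, -2), (2, 2, -6, -9, -14), (2, 2, -6, -8, -13),
    (2, 2, -5, -7, -11), (2, 2, -3, -4, -7), (2, 2, -2, -3, -5), (2, 2, 0, 0, -1)]"

text \<open>As e + f is at most 2, a step yields at most \<open>(b + 2, c + 4, a + c + 6)\<close>.
  The bounds -7, -9, -13 persist because -9 + 2 = -7, -13 + 4 = -9 and -7 - 13 + 6 = -14.\<close>

definition safe :: "nat \<Rightarrow> nat \<Rightarrow> int \<Rightarrow> int \<Rightarrow> int \<Rightarrow> bool" where
  "safe l m a b c \<longleftrightarrow> 0 \<le> a \<and> 0 \<le> b \<and> 0 \<le> c \<or> a \<le> - 7 \<and> b \<le> - 9 \<and> c \<le> - 13
    \<or> (min l m, max l m, a, b, c) \<in> set core"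

lemma safe_commute: "safe l m a b c = safe m l a b c"
  by (simp add: safe_def min.commute max.commute)

lemma core_closed:
  "list_all (\<lambda>(l, m, a, b, c). l \<le> m \<and>
    list_all (\<lambda>e. list_all (\<lambda>f. safe (nar_subst l ! e) (nar_subst m ! f)
        (b + int (e + f)) (c + 2 * int (e + f)) (a + c + 3 * int (e + f)))
      [0..<length (nar_subst m)]) [0..<length (nar_subst l)]) core"
  by code_simp

text \<open>-6 = -4 - 2 and -1 = 1 - 2, the 2 coming from counting both positions from 0. Both
  values of \<open>a\<close> also lie outside the two cones.\<close>

lemma core_avoids:
  "list_all (\<lambda>(l, m, a, b, c). \<not> (l = 1 \<and> m = 1 \<and> a = - 6) \<and> \<not> (l = 2 \<and> m = 2 \<and> a = - 1)) core"
  by code_simp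

lemma safe_step:
  assumes safe: "safe l m a b c" and e: "e < length (nar_subst l)" and f: "f < length (nar_subst m)"
  shows "safe (nar_subst l ! e) (nar_subst m ! f)
    (b + int (e + f)) (c + 2 * int (e + f)) (a + c + 3 * int (e + f))"
proof -
  have core: "safe (nar_subst l ! e) (nar_subst m ! f)
      (b + int (e + f)) (c + 2 * int (e + f)) (a + c + 3 * int (e + f))"
    if "(l, m, a, b, c) \<in> set core" "e < length (nar_subst l)" "f < length (nar_subst m)" for l m e f
    using core_closed that unfolding list_all_iff by fastforce
  have le: "e \<le> 1" "f \<le> 1"
    using e f by (auto simp: nar_subst_def split: if_splits)
  consider "0 \<le> a" "0 \<le> b" "0 \<le> c" | "a \<le> - 7" "b \<le> - 9" "c \<le> - 13"
    | "(l, m, a, b, c) \<in> set core" | "(m, l, a, b, c) \<in> set core"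
    using safe by (auto simp: safe_def min_def max_def split: if_splits)
  then show ?thesis
  proof cases
    case 1
    then show ?thesis by (simp add: safe_def)
  next
    case 2
    then show ?thesis using le by (simp add: safe_def)
  next
    case 3
    then show ?thesis using core e f by blast
  next
    case 4
    then show ?thesis
      using core[OF 4 f e] by (simp add: safe_commute add.commute)
  qed
qed

text \<open>Both positions are desubstituted, while \<open>narayana K\<close> moves to
  \<open>narayana (Suc K)\<close> by the same linear map with digit 0.\<close>

lemma safe_narayana:
  "safe (fixed_word !! x) (fixed_word !! y) (int x + int y - int (narayana K))
    (int (stretch x) + int (stretch y) - int (narayana (Suc K)))
    (int (stretch (stretch x)) + int (stretch (stretch y)) - int (narayana (Suc (Suc K))))"
proof (induction K arbitrary: x y)
  case 0
  \<comment> \<open>The vector of a nonzero position dominates (1, 2, 3), so the difference is in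
    the nonnegative cone unless both positions are 0.\<close>
  have ge: "1 \<le> z \<and> 2 \<le> stretch z \<and> 3 \<le> stretch (stretch z)" if "z \<noteq> 0" for z
  proof -
    have "narayana 0 \<le> z" using that by simp
    then have "narayana 1 \<le> stretch z"
      using stretch_mono stretch_narayana[of 0] by fastforce
    then have "narayana 2 \<le> stretch (stretch z)"
      using stretch_mono stretch_narayana[of 1] by (fastforce simp: eval_nat_numeral)
    with \<open>narayana 1 \<le> stretch z\<close> that show ?thesis by (simp add: eval_nat_numeral)
  qed
  show ?case
  proof (cases "x = 0 \<and> y = 0")
    case True
    have "safe 0 0 (- 1) (- 2) (- 3)" by code_simp
    then show ?thesis using True by (simp add: fixed_word_0)
  next
    case False
    then show ?thesis using ge[of x] ge[of y] by (auto simp: safe_def)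
  qed
next
  case (Suc K)
  obtain p e where x: "x = stretch p + e" and e: "e < length (nar_subst (fixed_word !! p))"
    by (rule position_in_image)
  obtain q f where y: "y = stretch q + f" and f: "f < length (nar_subst (fixed_word !! q))"
    by (rule position_in_image)
  show ?case
    using safe_step[OF Suc.IH[of p q] e f] fixed_word_stretch[OF e] fixed_word_stretch[OF f]
      stretch_child[OF e] stretch_child[OF f]
    by (simp add: x y algebra_simps)
qed

lemma PosE:
  assumes "k \<in> Pos i"
  obtains x where "k = Suc x" and "fixed_word !! x = i"
  using assms by (auto simp: Pos_def letter_def intro: that[of "k - 1"])

lemma narayana_minus_4_notin: "n + 4 = narayana K \<Longrightarrow> n \<notin> Pos 1 + Pos 1"
proof
  assume n: "n + 4 = narayana K" and "n \<in> Pos 1 + Pos 1"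
  then obtain x y where xy: "n = Suc x + Suc y" "fixed_word !! x = 1" "fixed_word !! y = 1"
    by (metis PosE set_plus_elim)
  then have a: "int x + int y - int (narayana K) = - 6"
    using n by linarith
  show False
    using safe_narayana[of x y K] core_avoids unfolding a xy(2,3)
    by (auto simp: safe_def list_all_iff)
qed

lemma narayana_plus_1_notin: "narayana K + 1 \<notin> Pos 2 + Pos 2"
proof
  assume "narayana K + 1 \<in> Pos 2 + Pos 2"
  then obtain x y where xy: "narayana K + 1 = Suc x + Suc y" "fixed_word !! x = 2" "fixed_word !! y = 2"
    by (metis PosE set_plus_elim)
  then have a: "int x + int y - int (narayana K) = - 1"
    by linarith
  show False
    using safe_narayana[of x y K] core_avoids unfolding a xy(2,3)
    by (auto simp: safe_def list_all_iff)
qed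

section \<open>Narayana values of the two exceptional families\<close>

lemma narayana_val_Nil: "narayana_val [] = 0"
  by (simp add: narayana_val_def)

lemma narayana_val_Cons: "narayana_val (e # u) = e * narayana (length u) + narayana_val u"
proof -
  have "narayana_val (e # u) = (\<Sum>i<Suc (length u). (e # u) ! i * narayana (length u - i))"
    unfolding narayana_val_def
    by (rule sum.reindex_bij_witness[of _ Suc "\<lambda>i. i - 1"]) auto
  moreover have "narayana_val u = (\<Sum>i<length u. u ! i * narayana (length u - Suc i))"
    unfolding narayana_val_def
    by (rule sum.reindex_bij_witness[of _ Suc "\<lambda>i. i - 1"]) auto
  ultimately show ?thesis
    by (simp add: sum.lessThan_Suc_shift del: sum.lessThan_Suc)
qed

lemma word_power_simps: "word_power u 0 = []" "word_power u (Suc i) = u @ word_power u i"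
  by (simp_all add: word_power_def)

lemma length_word_power: "length (word_power u i) = i * length u"
  by (induction i) (simp_all add: word_power_simps)

text \<open>A further block 100 in front contributes N_(3i+8), which is exactly N_(3i+9) -
  N_(3i+6).\<close>

lemma narayana_val_100:
  "narayana_val (word_power [1, 0, 0] i @ [1, 0, 0, 0, 0, 0]) + 4 = narayana (3 * i + 6)"
proof (induction i)
  case 0
  show ?case by (simp add: word_power_simps narayana_val_Cons narayana_val_Nil eval_nat_numeral)
next
  case (Suc i)
  define v where "v = word_power [1, 0, 0] i @ [1, 0, 0, 0, 0, 0::nat]"
  have len: "length v = 3 * i + 6"
    by (simp add: v_def length_word_power)
  have "narayana_val (word_power [1, 0, 0] (Suc i) @ [1, 0, 0, 0, 0, 0])
      = narayana_val (1 # 0 # 0 # v)"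
    by (simp add: v_def word_power_simps)
  also have "\<dots> = narayana (Suc (Suc (3 * i + 6))) + narayana_val v"
    by (simp add: narayana_val_Cons len)
  finally have "narayana_val (word_power [1, 0, 0] (Suc i) @ [1, 0, 0, 0, 0, 0]) + 4
      = narayana (Suc (Suc (3 * i + 6))) + narayana (3 * i + 6)"
    using Suc by (simp only: v_def)
  also have "\<dots> = narayana (3 * Suc i + 6)"
    using narayana.simps(4)[of "3 * i + 6"] by (simp add: add.commute)
  finally show ?case .
qed

lemma narayana_val_1_zeros_1:
  "narayana_val ([1] @ word_power [0, 0] i @ [1]) = narayana (2 * i + 1) + 1"
proof -
  have "narayana_val (word_power [0, 0] i @ u) = narayana_val u" for u
    by (induction i) (simp_all add: word_power_simps narayana_val_Cons)
  then show ?thesis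
    by (simp add: narayana_val_Cons narayana_val_Nil length_word_power mult_2 mult_2_right)
qed

section \<open>Sums of positions\<close>

definition letters_at :: "(nat \<Rightarrow> bool) \<Rightarrow> nat list \<Rightarrow> nat list \<Rightarrow> bool" where
  "letters_at Q u ks \<longleftrightarrow> list_all (\<lambda>k. 1 \<le> k \<and> k \<le> length u \<and> Q (u ! (k - 1))) ks"

lemma letters_at_pre:
  assumes "letters_at Q ((subst_word ^^ K) [0]) ks" and "k \<in> set ks"
  shows "1 \<le> k \<and> Q (letter k)"
proof -
  have k: "1 \<le> k" "k \<le> narayana K" "Q (pre (narayana K) ! (k - 1))"
    using assms by (auto simp: letters_at_def list_all_iff length_funpow_subst_word_0 pre_narayana)
  then show ?thesis
    by (simp add: letter_def stake_nth)
qed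

lemma Pos_1_elements: "{2, 6, 8, 11, 15, 25} \<subseteq> Pos 1"
proof -
  have "letters_at (\<lambda>a. a = 1) ((subst_word ^^ 8) [0]) [2, 6, 8, 11, 15, 25]" by code_simp
  from letters_at_pre[OF this] show ?thesis by (auto simp: Pos_def)
qed

lemma Pos_2_elements: "{3, 12, 31, 37, 53, 57, 63, 69, 72, 76, 97, 128} \<subseteq> Pos 2"
proof -
  have "letters_at (\<lambda>a. a = 2) ((subst_word ^^ 12) [0]) [3, 12, 31, 37, 53, 57, 63, 69, 72, 76, 97, 128]"
    by code_simp
  from letters_at_pre[OF this] show ?thesis by (auto simp: Pos_def)
qed

lemma sum_with_remainder:
  fixes n s :: nat
  assumes "s \<in> A" "s < n" "n - s \<in> B"
  shows "n \<in> A + B"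
proof -
  have "s + (n - s) \<in> A + B"
    using assms(1,3) by (rule set_plus_intro)
  moreover have "s + (n - s) = n"
    using assms(2) by simp
  ultimately show ?thesis by (simp only:)
qed

lemma pair_sum_in_set_plus:
  assumes "list_all (\<lambda>(k, l). k \<in> A \<and> l \<in> A) ps" and "s \<in> set (map (\<lambda>(k, l). k + l) ps)"
  shows "s \<in> A + A"
  using assms by (auto simp: list_all_iff)

lemma Pos02_plus_Pos02:
  assumes "n \<ge> 4"
  shows "n \<in> Pos02 + Pos02"
proof -
  \<comment> \<open>The shortest block is sigma^k(1), of length N_(k-2). Here and in the three
    further coverings, k is the least exponent for which it reaches the largest shift, and the
    cutoff is one below the bound on \<open>n\<close>, as \<open>c < n\<close> is strict.\<close>
  have cover: "shifts_cover (map (\<lambda>a. a \<in> {0, 2}) ((subst_word ^^ 5) [0, 1, 2, 0, 0, 1, 0])) 3 [1, 3, 4]"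
    by code_simp
  have long: "list_all (\<lambda>a. 4 \<le> length ((subst_word ^^ 5) [a])) [0, 1, 2]"
    by code_simp
  obtain s where s: "s \<in> set [1, 3, 4]" "s < n" "letter (n - s) \<in> {0, 2}"
    by (rule shifts_cover_fixed_word[OF cover long, of n]) (use assms in auto)
  have "letters_at (\<lambda>a. a \<in> {0, 2}) ((subst_word ^^ 3) [0]) [1, 3, 4]"
    by code_simp
  from letters_at_pre[OF this s(1)] show ?thesis
    using s by (intro sum_with_remainder[of s]) (auto simp: Pos02_def)
qed

lemma Pos_0_plus_Pos_0:
  assumes "n \<ge> 17"
  shows "n \<in> Pos 0 + Pos 0"
proof -
  have cover: "shifts_cover (map (\<lambda>a. a = 0) ((subst_word ^^ 10) [0, 1, 2, 0, 0, 1, 0])) 16 [5, 7, 13, 18, 24]"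
    by code_simp
  have long: "list_all (\<lambda>a. 24 \<le> length ((subst_word ^^ 10) [a])) [0, 1, 2]"
    by code_simp
  obtain s where s: "s \<in> set [5, 7, 13, 18, 24]" "s < n" "letter (n - s) = 0"
    by (rule shifts_cover_fixed_word[OF cover long, of n]) (use assms in auto)
  have "letters_at (\<lambda>a. a = 0) ((subst_word ^^ 8) [0]) [5, 7, 13, 18, 24]"
    by code_simp
  from letters_at_pre[OF this s(1)] show ?thesis
    using s by (intro sum_with_remainder[of s]) (auto simp: Pos_def)
qed

lemma Pos_1_plus_Pos_1_plus_Pos_1:
  assumes "n \<ge> 27"
  shows "n \<in> Pos 1 + Pos 1 + Pos 1"
proof -
  \<comment> \<open>Each shift is a sum of two elements of \<open>Pos 1\<close>, by the pairs listed
    below in the same order; the covering supplies the third summand.\<close>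
  let ?S = "[12, 13, 14, 19, 27, 30, 31]"
  have cover: "shifts_cover (map (\<lambda>a. a = 1) ((subst_word ^^ 11) [0, 1, 2, 0, 0, 1, 0])) 26 ?S"
    by code_simp
  have long: "list_all (\<lambda>a. 31 \<le> length ((subst_word ^^ 11) [a])) [0, 1, 2]"
    by code_simp
  obtain s where s: "s \<in> set ?S" "s < n" "letter (n - s) = 1"
    by (rule shifts_cover_fixed_word[OF cover long, of n]) (use assms in auto)
  have "list_all (\<lambda>(k, l). k \<in> Pos 1 \<and> l \<in> Pos 1) [(6, 6), (2, 11), (6, 8), (8, 11), (2, 25), (15, 15), (6, 25)]"
    using Pos_1_elements by simp
  from pair_sum_in_set_plus[OF this, of s] have "s \<in> Pos 1 + Pos 1"
    using s(1) by auto
  from sum_with_remainder[OF this s(2)] show ?thesis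
    using s(2,3) by (simp add: Pos_def)
qed

lemma Pos_2_plus_Pos_2_plus_Pos_2:
  assumes "n \<ge> 140"
  shows "n \<in> Pos 2 + Pos 2 + Pos 2"
proof -
  let ?S = "[15, 74, 90, 114, 132, 133, 134, 135, 139, 140, 159]"
  have cover: "shifts_cover (map (\<lambda>a. a = 2) ((subst_word ^^ 15) [0, 1, 2, 0, 0, 1, 0])) 139 ?S"
    by code_simp
  have long: "list_all (\<lambda>a. 159 \<le> length ((subst_word ^^ 15) [a])) [0, 1, 2]"
    by code_simp
  obtain s where s: "s \<in> set ?S" "s < n" "letter (n - s) = 2"
    by (rule shifts_cover_fixed_word[OF cover long, of n]) (use assms in auto)
  \<comment> \<open>The pairs sum to the entries of \<open>?S\<close> in order.\<close>
  have "list_all (\<lambda>(k, l). k \<in> Pos 2 \<and> l \<in> Pos 2) [(3, 12), (37, 37), (37, 53), (57, 57), (63, 69), (57, 76), (37, 97),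
      (63, 72), (63, 76), (12, 128), (31, 128)]"
    using Pos_2_elements by simp
  from pair_sum_in_set_plus[OF this, of s] have "s \<in> Pos 2 + Pos 2"
    using s(1) by auto
  from sum_with_remainder[OF this s(2)] show ?thesis
    using s(2,3) by (simp add: Pos_def)
qed

theorem theorem22:
  shows "(\<forall>n\<ge>4. n \<in> Pos02 + Pos02)
    \<and> (\<forall>n\<ge>17. n \<in> Pos 0 + Pos 0)
    \<and> (\<forall>i\<ge>0. narayana_val (word_power [1, 0, 0] i @ [1, 0, 0, 0, 0, 0]) \<notin> Pos 1 + Pos 1)
    \<and> (\<forall>n\<ge>27. n \<in> Pos 1 + Pos 1 + Pos 1)
    \<and> (\<forall>i\<ge>1. narayana_val ([1] @ word_power [0, 0] i @ [1]) \<notin> Pos 2 + Pos 2)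
    \<and> (\<forall>n\<ge>140. n \<in> Pos 2 + Pos 2 + Pos 2)"
  using Pos02_plus_Pos02 Pos_0_plus_Pos_0 narayana_minus_4_notin[OF narayana_val_100]
    Pos_1_plus_Pos_1_plus_Pos_1 narayana_plus_1_notin Pos_2_plus_Pos_2_plus_Pos_2
  unfolding narayana_val_1_zeros_1 by blast

end
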